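(* Let $\mathcal{D}$ be a data universe (as in the context) and let $f:\mathcal{D}\to\mathbb{R}$ be an arbitrary function to which we have query access, where a query on a database with $n$ entries takes time $T(n)$. Let $\{\Delta_i\}$ be non-negative sensitivity parameters and let $g:\mathcal{D}\to\mathbb{R}$ be the Sensitivity-Preprocessing Function of $f$ with parameters $\{\Delta_i\}$. Then for any database $D$ with $n$ entries, $g(D)$ can be computed in time $O((T(n)+n)2^n)$; moreover $\Delta_i(g)\le \Delta_i$ for all $i$, and for any database $D=(x_1,\dots,x_n)$, \[ |f(D)-g(D)| \le \max_{\sigma\in\sigma_D}\sum_{i=1}^{|D|}\max\left\{\left|f(D_{\sigma(<i)}+x_{\sigma(i)})-f(D_{\sigma(<i)})\right|-\Delta_{\sigma(i)},\,0\right\}, \] where $\sigma_D$ is the set of all permutations of $[n]$ and $D_{\sigma(<i)}=(x_{\sigma(1)},\dots,x_{\sigma(i-1)})$.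
   Context: There is a (possibly infinite) collection of individuals; a database $D$ is a finite set $\{x_i : i\in I\}$ of data records, one for each individual $i$ in some finite set $I$ (write $i\in D$ when $i\in I$). The data universe $\mathcal{D}$ is a collection of databases containing $\emptyset$ and closed under taking subsets. For $i\in D$, $D-x_i$ is $D$ with individual $i$'s record removed; for $i\notin D$, $D+x_i$ is $D$ with a record $x_i$ of individual $i$ added. The individual sensitivity of $h:\mathcal{D}\to\mathbb{R}$ with respect to $i$ is $\Delta_i(h)=\sup_{x_i,\ D:\, i\notin D}|h(D)-h(D+x_i)|$ (over $D, D+x_i\in\mathcal{D}$). Given $f:\mathcal{D}\to\mathbb{R}$ and non-negative parameters $\{\Delta_i\}$, the Sensitivity-Preprocessing Function $g$ of $f$ is defined recursively by $g(\emptyset)=f(\emptyset)$ and, for nonempty $D$, with $\textsc{Upper}(D)=\min_{j\in D}\{g(D-x_j)+\Delta_j\}$ and $\textsc{Lower}(D)=\max_{j\in D}\{g(D-x_j)-\Delta_j\}$: $g(D)=\textsc{Upper}(D)$ if $\textsc{Upper}(D)\le f(D)$; $g(D)=\textsc{Lower}(D)$ if $\textsc{Lower}(D)\ge f(D)$; and $g(D)=f(D)$ otherwise.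
   Formalization: The query time T is assumed non-decreasing; otherwise the time bound fails, e.g. T(n)=0 for even n and 4^n for odd n, where computing g(D) for even n can require querying all databases with n-1 entries. *)

theory Defs
  imports
    Complex_Main
    "HOL-Library.Finite_Map"
    "HOL-Library.Extended_Nonnegative_Real"
    "HOL-Library.Landau_Symbols"
    "HOL-Combinatorics.Permutations"
begin

section \<open>Databases\<close>

text \<open>
  A database is a finite map from individuals \<^typ>\<open>'i\<close> to records \<^typ>\<open>'r\<close>; removing the record
  of \<open>i\<close> is \<^const>\<open>fmdrop\<close>, adding a record for \<open>i\<close> is \<^const>\<open>fmupd\<close>, and \<open>D' \<subseteq> D\<close> is
  \<^const>\<open>fmsubset\<close>. When a database is listed as \<open>(x\<^sub>1, \<dots>, x\<^sub>n)\<close>, each entry is a pair of an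
  individual and its record.
\<close>

type_synonym ('i, 'r) database = "('i, 'r) fmap"

definition data_universe :: "('i, 'r) database set \<Rightarrow> bool" where
  "data_universe U \<longleftrightarrow> fmempty \<in> U \<and> (\<forall>D\<in>U. \<forall>D'. fmsubset D' D \<longrightarrow> D' \<in> U)"

definition lists_database :: "('i \<times> 'r) list \<Rightarrow> ('i, 'r) database \<Rightarrow> bool" where
  "lists_database xs D \<longleftrightarrow> distinct (map fst xs) \<and> fmap_of_list xs = D"

text \<open>
  The supremum is taken in \<^typ>\<open>ennreal\<close>: it is \<open>\<infinity>\<close> if the differences are unbounded, and \<open>0\<close> if
  there is no pair \<open>D\<close>, \<open>D + x\<^sub>i\<close> in the universe.
\<close>

definition individual_sensitivity ::
    "('i, 'r) database set \<Rightarrow> (('i, 'r) database \<Rightarrow> real) \<Rightarrow> 'i \<Rightarrow> ennreal" where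
  "individual_sensitivity U h i =
     (SUP (x, D) \<in> {(x, D). D \<in> U \<and> i \<notin> fmdom' D \<and> fmupd i x D \<in> U}.
        ennreal \<bar>h D - h (fmupd i x D)\<bar>)"

section \<open>The Sensitivity-Preprocessing Function\<close>

text \<open>
  The recursion evaluates \<open>f\<close> only at subsets of \<open>D\<close>, so on a data universe the values of \<open>f\<close>
  outside the universe play no role.
\<close>

function sens_prep ::
    "(('i, 'r) database \<Rightarrow> real) \<Rightarrow> ('i \<Rightarrow> real) \<Rightarrow> ('i, 'r) database \<Rightarrow> real" where
  "sens_prep f \<Delta> D =
     (if D = fmempty then f fmempty
      else let upper = Min ((\<lambda>j. sens_prep f \<Delta> (fmdrop j D) + \<Delta> j) ` fmdom' D);
               lower = Max ((\<lambda>j. sens_prep f \<Delta> (fmdrop j D) - \<Delta> j) ` fmdom' D)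
           in if upper \<le> f D then upper
              else if lower \<ge> f D then lower
              else f D)"
  by auto

termination
proof (relation "measure (\<lambda>(f, \<Delta>, D). card (fmdom' D))", goal_cases)
  case 1
  show ?case by simp
next
  case (2 f \<Delta> D j)
  then show ?case
    using card_Diff1_less[OF finite_fmdom', of j D] by simp
next
  case (3 f \<Delta> D u j)
  then show ?case
    using card_Diff1_less[OF finite_fmdom', of j D] by simp
qed

declare sens_prep.simps [simp del]

section \<open>The error bound\<close>

text \<open>
  Entries are numbered from \<open>0\<close>, so permutations act on \<open>{..<n}\<close>; \<open>prefix_db xs \<sigma> k\<close> consists of
  the first \<open>k\<close> entries of \<open>xs\<close> in the order given by \<open>\<sigma>\<close>.
\<close>

definition prefix_db :: "('i \<times> 'r) list \<Rightarrow> (nat \<Rightarrow> nat) \<Rightarrow> nat \<Rightarrow> ('i, 'r) database" where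
  "prefix_db xs \<sigma> k = fmap_of_list (map (\<lambda>j. xs ! \<sigma> j) [0..<k])"

definition perm_error ::
    "(('i, 'r) database \<Rightarrow> real) \<Rightarrow> ('i \<Rightarrow> real) \<Rightarrow> ('i \<times> 'r) list \<Rightarrow> (nat \<Rightarrow> nat) \<Rightarrow> real" where
  "perm_error f \<Delta> xs \<sigma> =
     (\<Sum>k<length xs.
        let i = fst (xs ! \<sigma> k); x = snd (xs ! \<sigma> k); E = prefix_db xs \<sigma> k
        in max (\<bar>f (fmupd i x E) - f E\<bar> - \<Delta> i) 0)"

section \<open>Model of computation\<close>

text \<open>
  Running times refer to a unit-cost random access machine with exact real arithmetic and an
  oracle for \<open>f\<close>, programmed in a while language. The store has two unbounded memories, one of
  natural numbers and one of real numbers, both addressed by natural numbers. The only arithmetic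
  is addition and (on naturals truncated) subtraction. For the input \<open>(x\<^sub>1, \<dots>, x\<^sub>n)\<close>, a program can
  read \<open>n\<close> (\<open>Size\<close>) and the sensitivity parameter belonging to an entry (\<open>Param\<close>); the records
  themselves are opaque and are referred to by their position in the input.
  \<open>Query a p k\<close> asks for the value of \<open>f\<close> on the database formed by the \<open>k\<close> entries whose (distinct)
  positions are stored at the addresses \<open>p, \<dots>, p + k - 1\<close>, so a program has to write down the
  database it queries; the answer is stored at the real address \<open>a\<close>.
\<close>

datatype nexp = NConst nat | Size | NMem nexp | NAdd nexp nexp | NSub nexp nexp

datatype rexp = RMem nexp | Param nexp | RAdd rexp rexp | RSub rexp rexp

datatype bexp = NLess nexp nexp | RLess rexp rexp | Neg bexp | Conj bexp bexp

datatype com =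
    NStore nexp nexp
  | RStore nexp rexp
  | Query nexp nexp nexp
  | Skip
  | Seq com com
  | Cond bexp com com
  | While bexp com

type_synonym store = "(nat \<Rightarrow> nat) \<times> (nat \<Rightarrow> real)"

fun nval :: "nat \<Rightarrow> nexp \<Rightarrow> store \<Rightarrow> nat" where
  "nval n (NConst c) s = c"
| "nval n Size s = n"
| "nval n (NMem a) s = fst s (nval n a s)"
| "nval n (NAdd a b) s = nval n a s + nval n b s"
| "nval n (NSub a b) s = nval n a s - nval n b s"

fun rval :: "('i \<Rightarrow> real) \<Rightarrow> ('i \<times> 'r) list \<Rightarrow> rexp \<Rightarrow> store \<Rightarrow> real" where
  "rval \<Delta> xs (RMem a) s = snd s (nval (length xs) a s)"
| "rval \<Delta> xs (Param a) s =
     (let k = nval (length xs) a s in if k < length xs then \<Delta> (fst (xs ! k)) else 0)"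
| "rval \<Delta> xs (RAdd a b) s = rval \<Delta> xs a s + rval \<Delta> xs b s"
| "rval \<Delta> xs (RSub a b) s = rval \<Delta> xs a s - rval \<Delta> xs b s"

fun bval :: "('i \<Rightarrow> real) \<Rightarrow> ('i \<times> 'r) list \<Rightarrow> bexp \<Rightarrow> store \<Rightarrow> bool" where
  "bval \<Delta> xs (NLess a b) s \<longleftrightarrow> nval (length xs) a s < nval (length xs) b s"
| "bval \<Delta> xs (RLess a b) s \<longleftrightarrow> rval \<Delta> xs a s < rval \<Delta> xs b s"
| "bval \<Delta> xs (Neg b) s \<longleftrightarrow> \<not> bval \<Delta> xs b s"
| "bval \<Delta> xs (Conj b c) s \<longleftrightarrow> bval \<Delta> xs b s \<and> bval \<Delta> xs c s"

text \<open>
  \<open>exec f T \<Delta> xs c s t s'\<close>: on input \<open>xs\<close>, the command \<open>c\<close> started in store \<open>s\<close> terminates in store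
  \<open>s'\<close> after time \<open>t\<close>. Every assignment and every test costs one unit, which agrees with charging
  each arithmetic operation separately up to a constant factor depending only on the program,
  since expressions are part of the program text. A query on a database with \<open>k\<close> entries costs
  \<open>T k\<close> in addition to one unit. A command whose query is ill-formed does not terminate.
\<close>

inductive exec ::
    "(('i, 'r) database \<Rightarrow> real) \<Rightarrow> (nat \<Rightarrow> nat) \<Rightarrow> ('i \<Rightarrow> real) \<Rightarrow> ('i \<times> 'r) list \<Rightarrow>
     com \<Rightarrow> store \<Rightarrow> nat \<Rightarrow> store \<Rightarrow> bool"
  for f :: "('i, 'r) database \<Rightarrow> real" and T :: "nat \<Rightarrow> nat"
    and \<Delta> :: "'i \<Rightarrow> real" and xs :: "('i \<times> 'r) list" where
  exec_NStore:
    "exec f T \<Delta> xs (NStore a e) s 1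
       ((fst s)(nval (length xs) a s := nval (length xs) e s), snd s)"
| exec_RStore:
    "exec f T \<Delta> xs (RStore a e) s 1
       (fst s, (snd s)(nval (length xs) a s := rval \<Delta> xs e s))"
| exec_Query:
    "ps = map (fst s) [nval (length xs) p s ..< nval (length xs) p s + nval (length xs) k s] \<Longrightarrow>
     distinct ps \<Longrightarrow> set ps \<subseteq> {..<length xs} \<Longrightarrow>
     exec f T \<Delta> xs (Query a p k) s (1 + T (length ps))
       (fst s, (snd s)(nval (length xs) a s := f (fmap_of_list (map (nth xs) ps))))"
| exec_Skip:
    "exec f T \<Delta> xs Skip s 1 s"
| exec_Seq:
    "exec f T \<Delta> xs c s t s' \<Longrightarrow> exec f T \<Delta> xs d s' u s'' \<Longrightarrow>
     exec f T \<Delta> xs (Seq c d) s (t + u) s''"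
| exec_CondT:
    "bval \<Delta> xs b s \<Longrightarrow> exec f T \<Delta> xs c s t s' \<Longrightarrow>
     exec f T \<Delta> xs (Cond b c d) s (1 + t) s'"
| exec_CondF:
    "\<not> bval \<Delta> xs b s \<Longrightarrow> exec f T \<Delta> xs d s t s' \<Longrightarrow>
     exec f T \<Delta> xs (Cond b c d) s (1 + t) s'"
| exec_WhileF:
    "\<not> bval \<Delta> xs b s \<Longrightarrow> exec f T \<Delta> xs (While b c) s 1 s"
| exec_WhileT:
    "bval \<Delta> xs b s \<Longrightarrow> exec f T \<Delta> xs c s t s' \<Longrightarrow> exec f T \<Delta> xs (While b c) s' u s'' \<Longrightarrow>
     exec f T \<Delta> xs (While b c) s (1 + t + u) s''"

inductive_cases exec_NStoreE: "exec f T \<Delta> xs (NStore a e) s t s'"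
inductive_cases exec_RStoreE: "exec f T \<Delta> xs (RStore a e) s t s'"
inductive_cases exec_QueryE: "exec f T \<Delta> xs (Query a p k) s t s'"
inductive_cases exec_SkipE: "exec f T \<Delta> xs Skip s t s'"
inductive_cases exec_SeqE: "exec f T \<Delta> xs (Seq c d) s t s'"
inductive_cases exec_CondE: "exec f T \<Delta> xs (Cond b c d) s t s'"
inductive_cases exec_WhileE: "exec f T \<Delta> xs (While b c) s t s'"

lemma exec_deterministic:
  "exec f T \<Delta> xs c s t s' \<Longrightarrow> exec f T \<Delta> xs c s u s'' \<Longrightarrow> u = t \<and> s'' = s'"
proof (induction arbitrary: u s'' rule: exec.induct)
  case exec_NStore
  from exec_NStore.prems show ?case by (rule exec_NStoreE) simp
next
  case exec_RStore
  from exec_RStore.prems show ?case by (rule exec_RStoreE) simp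
next
  case exec_Query
  from exec_Query.prems show ?case by (rule exec_QueryE) (simp add: exec_Query.hyps)
next
  case exec_Skip
  from exec_Skip.prems show ?case by (rule exec_SkipE) simp
next
  case exec_Seq
  from exec_Seq.prems show ?case by (rule exec_SeqE) (metis exec_Seq.IH)
next
  case exec_CondT
  from exec_CondT.prems show ?case
    by (rule exec_CondE) (metis exec_CondT.IH plus_1_eq_Suc, metis exec_CondT.hyps(1))
next
  case exec_CondF
  from exec_CondF.prems show ?case
    by (rule exec_CondE) (metis exec_CondF.hyps(1), metis exec_CondF.IH plus_1_eq_Suc)
next
  case exec_WhileF
  from exec_WhileF.prems show ?case
    by (rule exec_WhileE) (simp, metis exec_WhileF.hyps(1))
next
  case exec_WhileT
  from exec_WhileT.prems show ?case
    by (rule exec_WhileE)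
       (metis exec_WhileT.hyps(1), metis exec_WhileT.IH add_Suc plus_1_eq_Suc)
qed

text \<open>Both memories are initially zero; the result is found at real address \<open>0\<close>.\<close>

definition computes_within ::
    "com \<Rightarrow> (('i, 'r) database \<Rightarrow> real) \<Rightarrow> (nat \<Rightarrow> nat) \<Rightarrow> ('i \<Rightarrow> real) \<Rightarrow> ('i \<times> 'r) list \<Rightarrow>
     real \<Rightarrow> nat \<Rightarrow> bool" where
  "computes_within P f T \<Delta> xs v b \<longleftrightarrow>
     (\<exists>t s. exec f T \<Delta> xs P (\<lambda>_. 0, \<lambda>_. 0) t s \<and> snd s 0 = v \<and> t \<le> b)"

end

theory Submission
  imports Defs
begin

text \<open>
  Sensitivity: by induction on the size, the values \<open>g (D - x\<^sub>j)\<close> and \<open>g (D - x\<^sub>k)\<close> differ by at most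
  \<open>\<Delta>\<^sub>j + \<Delta>\<^sub>k\<close>, since both are close to \<open>g (D - x\<^sub>j - x\<^sub>k)\<close>. Hence \<open>Lower D \<le> Upper D\<close> and the clipped
  value lies between them.

  Error: where \<open>g D\<close> is clipped, it is \<open>g (D - x\<^sub>j) \<plusminus> \<Delta>\<^sub>j\<close> for an extremal \<open>j\<close>, so removing \<open>x\<^sub>j\<close> changes
  the error by at most \<open>max {\<bar>f D - f (D - x\<^sub>j)\<bar> - \<Delta>\<^sub>j, 0}\<close>; taking \<open>j\<close> as the last entry of the
  ordering gives a permutation by induction.

  Running time: subsets of the \<open>n\<close> entries are encoded as bit masks below \<open>2\<^sup>n\<close> and treated in
  increasing order, so that the masks \<open>m - 2\<^sup>j\<close> of all smaller databases precede \<open>m\<close>. Decoding a mask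
  greedily from the highest bit takes linear time without division and yields both the list of
  positions that the query needs and the running minimum and maximum.
\<close>

section \<open>Sensitivity and error\<close>

lemma sens_prep_Lipschitz:
  assumes nonneg: "\<And>i. 0 \<le> \<Delta> i" and "j \<in> fmdom' D"
  shows "\<bar>sens_prep f \<Delta> D - sens_prep f \<Delta> (fmdrop j D)\<bar> \<le> \<Delta> j"
  using assms(2)
proof (induction "card (fmdom' D)" arbitrary: D j rule: less_induct)
  case less
  let ?g = "sens_prep f \<Delta>"
  let ?up = "(\<lambda>i. ?g (fmdrop i D) + \<Delta> i) ` fmdom' D"
  let ?lo = "(\<lambda>i. ?g (fmdrop i D) - \<Delta> i) ` fmdom' D"
  have cross: "?g (fmdrop k D) - \<Delta> k \<le> ?g (fmdrop i D) + \<Delta> i"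
    if i: "i \<in> fmdom' D" and k: "k \<in> fmdom' D" for i k
  proof (cases "i = k")
    case True
    with nonneg[of i] show ?thesis by simp
  next
    case False
    have small: "card (fmdom' (fmdrop l D)) < card (fmdom' D)" if "l \<in> fmdom' D" for l
      using card_Diff1_less[OF finite_fmdom' that] by simp
    have "\<bar>?g (fmdrop i D) - ?g (fmdrop k (fmdrop i D))\<bar> \<le> \<Delta> k"
      using less.hyps[OF small[OF i], of k] k False by simp
    moreover have "\<bar>?g (fmdrop k D) - ?g (fmdrop i (fmdrop k D))\<bar> \<le> \<Delta> i"
      using less.hyps[OF small[OF k], of i] i False by simp
    ultimately show ?thesis
      by (simp add: fmdrop_comm[of i k])
  qed
  have ne: "D \<noteq> fmempty" using less.prems by auto
  have nonempty: "?up \<noteq> {}" "?lo \<noteq> {}" using less.prems by auto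
  have fin: "finite ?up" "finite ?lo" by simp_all
  have up: "Min ?up \<le> ?g (fmdrop j D) + \<Delta> j" and lo: "?g (fmdrop j D) - \<Delta> j \<le> Max ?lo"
    using less.prems by (auto intro!: Min_le Max_ge)
  moreover have "Max ?lo \<le> Min ?up"
    using fin nonempty cross by auto
  ultimately show ?case
    by (subst sens_prep.simps) (simp add: ne Let_def abs_le_iff)
qed

lemma individual_sensitivity_sens_prep:
  fixes f :: "('i, 'r) database \<Rightarrow> real"
  assumes "\<And>i. 0 \<le> \<Delta> i"
  shows "individual_sensitivity U (sens_prep f \<Delta>) i \<le> ennreal (\<Delta> i)"
  unfolding individual_sensitivity_def
proof (rule SUP_least, clarify)
  fix x and D :: "('i, 'r) database"
  assume "i \<notin> fmdom' D"
  then have "fmdrop i (fmupd i x D) = D"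
    by (intro fmap_ext) (auto simp: fmlookup_dom'_iff)
  with sens_prep_Lipschitz[OF assms, of i "fmupd i x D" f]
  show "ennreal \<bar>sens_prep f \<Delta> D - sens_prep f \<Delta> (fmupd i x D)\<bar> \<le> ennreal (\<Delta> i)"
    by (intro ennreal_leI) (simp add: abs_minus_commute)
qed

lemma prefix_db_id: "k \<le> length xs \<Longrightarrow> prefix_db xs id k = fmap_of_list (take k xs)"
  unfolding prefix_db_def by (auto intro!: arg_cong[of _ _ fmap_of_list] nth_equalityI)

lemma perm_error_snoc:
  "perm_error f \<Delta> (xs @ [(i, x)]) id = perm_error f \<Delta> xs id +
     max (\<bar>f (fmupd i x (fmap_of_list xs)) - f (fmap_of_list xs)\<bar> - \<Delta> i) 0"
proof -
  have "prefix_db (xs @ [(i, x)]) id k = prefix_db xs id k" if "k < length xs" for k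
    using that by (simp add: prefix_db_id)
  then show ?thesis
    by (simp add: perm_error_def Let_def prefix_db_id[of "length xs"] nth_append
        prefix_db_id cong: sum.cong_simp)
qed

lemma perm_error_permute_list:
  assumes "\<sigma> permutes {..<length xs}"
  shows "perm_error f \<Delta> (permute_list \<sigma> xs) id = perm_error f \<Delta> xs \<sigma>"
proof -
  have "prefix_db (permute_list \<sigma> xs) id k = prefix_db xs \<sigma> k" if "k < length xs" for k
    using that assms unfolding prefix_db_def
    by (auto intro!: arg_cong[of _ _ fmap_of_list] simp: permute_list_nth)
  then show ?thesis
    using assms by (simp add: perm_error_def permute_list_nth Let_def)
qed

lemma lists_database_snoc:
  assumes "lists_database xs (fmdrop i D)" "fmlookup D i = Some x"
  shows "lists_database (xs @ [(i, x)]) D"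
proof -
  have xs: "fmap_of_list xs = fmdrop i D" "distinct (map fst xs)"
    using assms(1) by (auto simp: lists_database_def)
  have look: "map_of xs k = fmlookup (fmdrop i D) k" for k
    by (metis fmap_of_list.rep_eq xs(1))
  have "i \<notin> fst ` set xs"
    using look[of i] by (simp add: map_of_eq_None_iff del: fset_of_list.rep_eq)
  moreover have "fmap_of_list (xs @ [(i, x)]) = D"
    using assms(2)
    by (intro fmap_ext) (simp add: fmap_of_list.rep_eq map_add_def look split: option.split del: fmap_of_list_app)
  ultimately show ?thesis
    using xs(2) by (simp add: lists_database_def)
qed

lemma lists_database_mset:
  assumes "lists_database xs D" "lists_database ys D"
  shows "mset xs = mset ys"
proof -
  have "map_of xs = map_of ys" and dist: "distinct (map fst xs)" "distinct (map fst ys)"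
    using assms by (auto simp: lists_database_def fmap_of_list.rep_eq dest!: arg_cong[of _ _ fmlookup])
  then have "set xs = set ys"
    by (metis map_of_eq_Some_iff subrelI equalityI)
  with dist show ?thesis
    by (simp add: set_eq_iff_mset_eq_distinct distinct_map)
qed

lemma sens_prep_error_ordering:
  "\<exists>ys. lists_database ys D \<and> \<bar>f D - sens_prep f \<Delta> D\<bar> \<le> perm_error f \<Delta> ys id"
proof (induction "card (fmdom' D)" arbitrary: D rule: less_induct)
  case less
  let ?g = "sens_prep f \<Delta>"
  show ?case
  proof (cases "D = fmempty")
    case True
    then show ?thesis
      by (intro exI[of _ "[]"]) (simp add: lists_database_def perm_error_def sens_prep.simps)
  next
    case False
    then have ne: "fmdom' D \<noteq> {}"
      by (metis fmdom'_empty fmrestrict_set_dom fmrestrict_set_null)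
    have ext: "\<exists>ys. lists_database ys D \<and>
        \<bar>f (fmdrop j D) - ?g (fmdrop j D)\<bar> + max (\<bar>f D - f (fmdrop j D)\<bar> - \<Delta> j) 0
          \<le> perm_error f \<Delta> ys id" if j: "j \<in> fmdom' D" for j
    proof -
      obtain x where x: "fmlookup D j = Some x" using j by (auto simp: fmlookup_dom'_iff)
      obtain ys where ys: "lists_database ys (fmdrop j D)"
          "\<bar>f (fmdrop j D) - ?g (fmdrop j D)\<bar> \<le> perm_error f \<Delta> ys id"
        using less[of "fmdrop j D"] card_Diff1_less[OF finite_fmdom' j] by auto
      have "fmap_of_list ys = fmdrop j D" using ys(1) by (simp add: lists_database_def)
      moreover have "fmupd j x (fmdrop j D) = D"
        using x by (intro fmap_ext) auto
      ultimately show ?thesis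
        using ys lists_database_snoc[OF ys(1) x]
        by (intro exI[of _ "ys @ [(j, x)]"]) (simp add: perm_error_snoc)
    qed
    let ?up = "(\<lambda>i. ?g (fmdrop i D) + \<Delta> i) ` fmdom' D"
    let ?lo = "(\<lambda>i. ?g (fmdrop i D) - \<Delta> i) ` fmdom' D"
    have "Min ?up \<in> ?up" "Max ?lo \<in> ?lo" using ne by simp_all
    then obtain i k where i: "i \<in> fmdom' D" "Min ?up = ?g (fmdrop i D) + \<Delta> i"
      and k: "k \<in> fmdom' D" "Max ?lo = ?g (fmdrop k D) - \<Delta> k" by blast
    consider (up) "?g D = ?g (fmdrop i D) + \<Delta> i" "?g D \<le> f D"
      | (lo) "?g D = ?g (fmdrop k D) - \<Delta> k" "f D \<le> ?g D" | (same) "?g D = f D"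
      using sens_prep.simps[of f \<Delta> D] False i k by (auto simp: Let_def split: if_splits)
    then show ?thesis
    proof cases
      case up
      with ext[OF i(1)] show ?thesis by fastforce
    next
      case lo
      with ext[OF k(1)] show ?thesis by fastforce
    next
      case same
      with ext[OF i(1)] show ?thesis by fastforce
    qed
  qed
qed

lemma sens_prep_error:
  assumes "lists_database xs D"
  shows "\<bar>f D - sens_prep f \<Delta> D\<bar> \<le> Max (perm_error f \<Delta> xs ` {\<sigma>. \<sigma> permutes {..<length xs}})"
proof -
  obtain ys where ys: "lists_database ys D" "\<bar>f D - sens_prep f \<Delta> D\<bar> \<le> perm_error f \<Delta> ys id"
    using sens_prep_error_ordering by blast
  obtain \<sigma> where \<sigma>: "\<sigma> permutes {..<length xs}" "permute_list \<sigma> xs = ys"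
    using mset_eq_permutation[OF lists_database_mset[OF ys(1) assms]] .
  have "perm_error f \<Delta> xs \<sigma> \<le> Max (perm_error f \<Delta> xs ` {\<sigma>. \<sigma> permutes {..<length xs}})"
    using \<sigma>(1) by (intro Max_ge) (auto simp: finite_permutations)
  with ys(2) perm_error_permute_list[OF \<sigma>(1)] \<sigma>(2) show ?thesis by simp
qed

section \<open>Databases as bit masks\<close>

definition high_bits :: "nat \<Rightarrow> nat \<Rightarrow> nat \<Rightarrow> nat list" where
  "high_bits n m j = rev (filter (bit m) [j..<n])"

definition db_of_mask :: "('i \<times> 'r) list \<Rightarrow> nat \<Rightarrow> ('i, 'r) database" where
  "db_of_mask xs m = fmap_of_list (map (nth xs) (high_bits (length xs) m 0))"

lemma high_bits_top [simp]: "high_bits n m n = []"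
  by (simp add: high_bits_def)

lemma high_bits_step:
  "j < n \<Longrightarrow> high_bits n m j = high_bits n m (Suc j) @ (if bit m j then [j] else [])"
  by (simp add: high_bits_def upt_conv_Cons)

lemma set_high_bits [simp]: "set (high_bits n m j) = {i. j \<le> i \<and> i < n \<and> bit m i}"
  by (auto simp: high_bits_def)

lemma distinct_high_bits: "distinct (high_bits n m j)"
  by (simp add: high_bits_def)

lemma length_high_bits: "length (high_bits n m j) \<le> n"
  using length_filter_le[of "bit m" "[j..<n]"] by (simp add: high_bits_def)

lemma distinct_map_fst_nth:
  assumes "distinct (map fst xs)" "distinct ps" "set ps \<subseteq> {..<length xs}"
  shows "distinct (map fst (map (nth xs) ps))"
proof -
  have "map fst (map (nth xs) ps) = map (nth (map fst xs)) ps"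
    using assms(3) by auto
  moreover have "inj_on (nth (map fst xs)) (set ps)"
    using assms(1,3) by (intro inj_on_nth) auto
  ultimately show ?thesis
    using assms(2) by (simp only: distinct_map simp_thms)
qed

lemma fmlookup_db_of_mask:
  assumes "distinct (map fst xs)"
  shows "fmlookup (db_of_mask xs m) i = Some x \<longleftrightarrow> (\<exists>p<length xs. bit m p \<and> xs ! p = (i, x))"
proof -
  let ?ys = "map (nth xs) (high_bits (length xs) m 0)"
  have "distinct (map fst ?ys)"
    using assms by (intro distinct_map_fst_nth) (auto simp: distinct_high_bits)
  then show ?thesis
    by (simp add: db_of_mask_def fmap_of_list.rep_eq map_of_eq_Some_iff del: map_map)
       (auto simp: image_iff)
qed

lemma fmdom'_db_of_mask:
  assumes "distinct (map fst xs)"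
  shows "fmdom' (db_of_mask xs m) = (\<lambda>p. fst (xs ! p)) ` {p. p < length xs \<and> bit m p}"
proof -
  have "i \<in> fmdom' (db_of_mask xs m) \<longleftrightarrow> (\<exists>p<length xs. bit m p \<and> fst (xs ! p) = i)" for i
    unfolding fmlookup_dom'_iff fmlookup_db_of_mask[OF assms] by (metis fst_conv prod.collapse)
  then show ?thesis
    by (auto simp: set_eq_iff image_iff)
qed

lemma bit_nat_diff_exp:
  assumes "bit (m :: nat) j"
  shows "m - 2 ^ j = unset_bit j m" "m - 2 ^ j < m"
proof -
  have "2 ^ j + unset_bit j m = or (2 ^ j) (unset_bit j m)"
    by (rule disjunctive_add_eq_or) (auto simp: bit_eq_iff bit_simps)
  also have "\<dots> = m"
    using assms by (intro bit_eqI) (auto simp: bit_simps)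
  finally show "m - 2 ^ j = unset_bit j m"
    by linarith
  show "m - 2 ^ j < m"
    using assms by (intro diff_less) (auto intro: gr0I)
qed

lemma fmdrop_db_of_mask:
  assumes "distinct (map fst xs)" "p < length xs" "bit m p"
  shows "fmdrop (fst (xs ! p)) (db_of_mask xs m) = db_of_mask xs (m - 2 ^ p)"
proof (rule fmap_ext)
  fix i
  have inj: "q = p" if "q < length xs" "xs ! q = (fst (xs ! p), x)" for q x
    using assms that nth_eq_iff_index_eq[of "map fst xs" q p] by simp
  have "fmlookup (fmdrop (fst (xs ! p)) (db_of_mask xs m)) i = Some x \<longleftrightarrow>
      fmlookup (db_of_mask xs (m - 2 ^ p)) i = Some x" for x
    unfolding fmlookup_drop bit_nat_diff_exp(1)[OF assms(3)]
    by (auto dest: inj simp: fmlookup_db_of_mask[OF assms(1)] bit_unset_bit_iff)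
  then show "fmlookup (fmdrop (fst (xs ! p)) (db_of_mask xs m)) i =
      fmlookup (db_of_mask xs (m - 2 ^ p)) i"
    by (metis not_Some_eq)
qed

lemma db_of_mask_full:
  assumes "lists_database xs D"
  shows "db_of_mask xs (2 ^ length xs - 1) = D"
proof (rule fmap_ext)
  fix i
  have dist: "distinct (map fst xs)" and D: "fmap_of_list xs = D"
    using assms by (simp_all add: lists_database_def)
  have "bit (2 ^ length xs - 1 :: nat) p" if "p < length xs" for p
    unfolding mask_eq_exp_minus_1[symmetric] using that by (simp add: bit_mask_iff)
  then have "fmlookup (db_of_mask xs (2 ^ length xs - 1)) i = Some x \<longleftrightarrow> fmlookup D i = Some x" for x
    using dist by (auto simp: fmlookup_db_of_mask D[symmetric] fmap_of_list.rep_eq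
        map_of_eq_Some_iff in_set_conv_nth)
  then show "fmlookup (db_of_mask xs (2 ^ length xs - 1)) i = fmlookup D i"
    by (metis not_Some_eq)
qed

lemma sens_prep_db_of_mask:
  fixes f :: "('i, 'r) database \<Rightarrow> real" and \<Delta> :: "'i \<Rightarrow> real" and m :: nat
  assumes "distinct (map fst xs)"
  defines "g \<equiv> \<lambda>m. sens_prep f \<Delta> (db_of_mask xs m)"
  defines "A \<equiv> {p. p < length xs \<and> bit m p}"
  defines "up \<equiv> Min ((\<lambda>p. g (m - 2 ^ p) + \<Delta> (fst (xs ! p))) ` A)"
  defines "lo \<equiv> Max ((\<lambda>p. g (m - 2 ^ p) - \<Delta> (fst (xs ! p))) ` A)"
  shows "g m = (if A \<noteq> {} \<and> up \<le> f (db_of_mask xs m) then up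
    else if A \<noteq> {} \<and> f (db_of_mask xs m) \<le> lo then lo else f (db_of_mask xs m))"
proof (cases "A = {}")
  case True
  then have "fmdom' (db_of_mask xs m) = {}"
    using fmdom'_db_of_mask[OF assms(1), of m] by (simp add: A_def)
  then have "db_of_mask xs m = fmempty"
    by (metis fmdom'_empty fmrestrict_set_dom fmrestrict_set_null)
  then show ?thesis
    using True by (simp add: g_def sens_prep.simps)
next
  case False
  have dom: "fmdom' (db_of_mask xs m) = (\<lambda>p. fst (xs ! p)) ` A"
    using fmdom'_db_of_mask[OF assms(1), of m] by (simp add: A_def)
  with False have "db_of_mask xs m \<noteq> fmempty" by auto
  moreover have "sens_prep f \<Delta> (fmdrop (fst (xs ! p)) (db_of_mask xs m)) = g (m - 2 ^ p)"
    if "p \<in> A" for p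
    using that fmdrop_db_of_mask[OF assms(1), of p m] by (simp add: A_def g_def)
  ultimately show ?thesis
    using False
    by (simp add: g_def sens_prep.simps[of f \<Delta> "db_of_mask xs m"] dom image_image up_def lo_def
        Let_def cong: image_cong_simp)
qed

lemma take_bit_Suc_nat: "take_bit (Suc j) (m :: nat) = of_bool (bit m j) * 2 ^ j + take_bit j m"
  by (simp add: take_bit_eq_mod bit_iff_odd mod_mult2_eq mod_2_eq_odd mult.commute[of 2])

lemma le_take_bit_Suc_iff: "2 ^ j \<le> take_bit (Suc j) (m :: nat) \<longleftrightarrow> bit m j"
  using take_bit_nat_less_exp[of j m] by (auto simp: take_bit_Suc_nat not_le)

section \<open>Execution within a time bound\<close>

definition runs ::
    "(('i, 'r) database \<Rightarrow> real) \<Rightarrow> (nat \<Rightarrow> nat) \<Rightarrow> ('i \<Rightarrow> real) \<Rightarrow> ('i \<times> 'r) list \<Rightarrow>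
     com \<Rightarrow> store \<Rightarrow> nat \<Rightarrow> (store \<Rightarrow> bool) \<Rightarrow> bool" where
  "runs f T \<Delta> xs c s b Q \<longleftrightarrow> (\<exists>t s'. exec f T \<Delta> xs c s t s' \<and> t \<le> b \<and> Q s')"

lemma runs_mono:
  "runs f T \<Delta> xs c s b Q \<Longrightarrow> b \<le> b' \<Longrightarrow> (\<And>s'. Q s' \<Longrightarrow> Q' s') \<Longrightarrow> runs f T \<Delta> xs c s b' Q'"
  unfolding runs_def by (meson order_trans)

lemma runs_Skip: "1 \<le> b \<Longrightarrow> Q s \<Longrightarrow> runs f T \<Delta> xs Skip s b Q"
  unfolding runs_def by (blast intro: exec.intros)

lemma runs_NStore:
  "1 \<le> b \<Longrightarrow> Q ((fst s)(nval (length xs) a s := nval (length xs) e s), snd s) \<Longrightarrow>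
   runs f T \<Delta> xs (NStore a e) s b Q"
  unfolding runs_def by (blast intro: exec.intros)

lemma runs_RStore:
  "1 \<le> b \<Longrightarrow> Q (fst s, (snd s)(nval (length xs) a s := rval \<Delta> xs e s)) \<Longrightarrow>
   runs f T \<Delta> xs (RStore a e) s b Q"
  unfolding runs_def by (blast intro: exec.intros)

lemma runs_Query:
  "map (fst s) [nval (length xs) p s ..< nval (length xs) p s + nval (length xs) k s] = ps \<Longrightarrow>
   distinct ps \<Longrightarrow> set ps \<subseteq> {..<length xs} \<Longrightarrow> 1 + T (length ps) \<le> b \<Longrightarrow>
   Q (fst s, (snd s)(nval (length xs) a s := f (fmap_of_list (map (nth xs) ps)))) \<Longrightarrow>
   runs f T \<Delta> xs (Query a p k) s b Q"
  unfolding runs_def by (blast intro: exec.intros)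

lemma runs_Seq:
  assumes "runs f T \<Delta> xs c s b R" "\<And>s'. R s' \<Longrightarrow> runs f T \<Delta> xs d s' b' Q" "b + b' \<le> b''"
  shows "runs f T \<Delta> xs (Seq c d) s b'' Q"
  using assms unfolding runs_def by (meson add_mono exec_Seq order_trans)

lemma runs_Cond:
  assumes "1 \<le> b" "bval \<Delta> xs t s \<Longrightarrow> runs f T \<Delta> xs c s (b - 1) Q"
    "\<not> bval \<Delta> xs t s \<Longrightarrow> runs f T \<Delta> xs d s (b - 1) Q"
  shows "runs f T \<Delta> xs (Cond t c d) s b Q"
proof -
  have "1 + u \<le> b" if "u \<le> b - 1" for u
    using that assms(1) by simp
  then show ?thesis
    using assms(2,3) unfolding runs_def by (metis exec_CondF exec_CondT)
qed

lemma runs_While: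
  assumes step: "\<And>i s. i < N \<Longrightarrow> I i s \<Longrightarrow> bval \<Delta> xs t s \<and> runs f T \<Delta> xs c s b (I (Suc i))"
    and exit: "\<And>s. I N s \<Longrightarrow> \<not> bval \<Delta> xs t s"
    and init: "I 0 s"
  shows "runs f T \<Delta> xs (While t c) s (N * (b + 1) + 1) (I N)"
proof -
  have "runs f T \<Delta> xs (While t c) s (d * (b + 1) + 1) (I N)" if "I i s" "i + d = N" for i d s
    using that
  proof (induction d arbitrary: i s)
    case 0
    then show ?case
      using exit[of s] unfolding runs_def
      by (intro exI[of _ 1] exI[of _ s]) (auto intro!: exec_WhileF[unfolded One_nat_def])
  next
    case (Suc d)
    from step[of i s] Suc.prems obtain u s' where
      "bval \<Delta> xs t s" "exec f T \<Delta> xs c s u s'" "u \<le> b" "I (Suc i) s'"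
      unfolding runs_def by auto
    moreover from Suc.IH[OF this(4)] Suc.prems(2) obtain v s'' where
      "exec f T \<Delta> xs (While t c) s' v s''" "v \<le> d * (b + 1) + 1" "I N s''"
      unfolding runs_def by auto
    ultimately show ?case
      unfolding runs_def
      by (intro exI[of _ "1 + u + v"] exI[of _ s''] conjI exec_WhileT) auto
  qed
  from this[OF init] show ?thesis by simp
qed

lemma runs_Seq_NStore:
  "1 \<le> b \<Longrightarrow>
   runs f T \<Delta> xs d ((fst s)(nval (length xs) a s := nval (length xs) e s), snd s) (b - 1) Q \<Longrightarrow>
   runs f T \<Delta> xs (Seq (NStore a e) d) s b Q"
  by (rule runs_Seq[where b = 1 and b' = "b - 1" and b'' = b and R = "\<lambda>s'. s' = _"], rule runs_NStore) auto

lemma runs_Seq_RStore: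
  "1 \<le> b \<Longrightarrow>
   runs f T \<Delta> xs d (fst s, (snd s)(nval (length xs) a s := rval \<Delta> xs e s)) (b - 1) Q \<Longrightarrow>
   runs f T \<Delta> xs (Seq (RStore a e) d) s b Q"
  by (rule runs_Seq[where b = 1 and b' = "b - 1" and b'' = b and R = "\<lambda>s'. s' = _"], rule runs_RStore) auto

lemma runs_Seq_Cond_RStore:
  assumes "runs f T \<Delta> xs d (nm, rm') b Q" "2 + b \<le> b'"
    "(if bval \<Delta> xs t (nm, rm) then rm(nval (length xs) a (nm, rm) := rval \<Delta> xs e (nm, rm)) else rm) = rm'"
  shows "runs f T \<Delta> xs (Seq (Cond t (RStore a e) Skip) d) (nm, rm) b' Q"
proof (rule runs_Seq[OF _ _ assms(2)])
  show "runs f T \<Delta> xs (Cond t (RStore a e) Skip) (nm, rm) 2 (\<lambda>s'. s' = (nm, rm'))"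
    using assms(3) by (intro runs_Cond runs_RStore runs_Skip) auto
qed (use assms(1) in auto)

section \<open>The dynamic program\<close>

text \<open>
  Memory layout. Natural addresses: 0 the current mask, 2 the current position, 3 the part of the
  mask not yet decoded, 4 the number of positions found, 5 to \<open>n + 5\<close> the powers of 2 and from
  \<open>n + 6\<close> on the positions found. Real addresses: 0 the current value, 1 and 2 the running values of
  \<open>Upper\<close> and \<open>Lower\<close> (meaningless until a position has been found), and \<open>m + 3\<close> the value at mask
  \<open>m\<close>. The full mask is treated last, so the result stays at address 0.
\<close>

abbreviation (input) mask_var :: nexp where "mask_var \<equiv> NMem (NConst 0)"
abbreviation (input) index_var :: nexp where "index_var \<equiv> NMem (NConst 2)"
abbreviation (input) rest_var :: nexp where "rest_var \<equiv> NMem (NConst 3)"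
abbreviation (input) size_var :: nexp where "size_var \<equiv> NMem (NConst 4)"
abbreviation (input) power_addr :: "nexp \<Rightarrow> nexp" where "power_addr e \<equiv> NAdd (NConst 5) e"
abbreviation (input) list_addr :: "nexp \<Rightarrow> nexp" where "list_addr e \<equiv> NAdd (NAdd (NConst 6) Size) e"
abbreviation (input) table_addr :: "nexp \<Rightarrow> nexp" where "table_addr e \<equiv> NAdd (NConst 3) e"
abbreviation (input) smaller_value :: rexp where
  "smaller_value \<equiv> RMem (table_addr (NSub mask_var (NMem (power_addr index_var))))"

definition double_prog :: com where
  "double_prog =
     Seq (NStore (NAdd (NConst 6) index_var)
           (NAdd (NMem (power_addr index_var)) (NMem (power_addr index_var))))
         (NStore (NConst 2) (NAdd index_var (NConst 1)))"

definition powers_prog :: com where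
  "powers_prog = Seq (NStore (NConst 5) (NConst 1)) (While (NLess index_var Size) double_prog)"

definition upper_prog :: com where
  "upper_prog =
     Cond (Neg (Conj (NLess (NConst 0) size_var)
            (Neg (RLess (RAdd smaller_value (Param index_var)) (RMem (NConst 1))))))
       (RStore (NConst 1) (RAdd smaller_value (Param index_var))) Skip"

definition lower_prog :: com where
  "lower_prog =
     Cond (Neg (Conj (NLess (NConst 0) size_var)
            (Neg (RLess (RMem (NConst 2)) (RSub smaller_value (Param index_var))))))
       (RStore (NConst 2) (RSub smaller_value (Param index_var))) Skip"

definition append_prog :: com where
  "append_prog =
     Seq (NStore (list_addr size_var) index_var)
    (Seq (NStore (NConst 4) (NAdd size_var (NConst 1)))
         (NStore (NConst 3) (NSub rest_var (NMem (power_addr index_var)))))"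

definition bit_prog :: com where
  "bit_prog =
     Seq (NStore (NConst 2) (NSub index_var (NConst 1)))
       (Cond (NLess rest_var (NMem (power_addr index_var))) Skip
         (Seq upper_prog (Seq lower_prog append_prog)))"

definition choose_prog :: com where
  "choose_prog =
     Cond (Conj (NLess (NConst 0) size_var) (Neg (RLess (RMem (NConst 0)) (RMem (NConst 1)))))
       (RStore (NConst 0) (RMem (NConst 1)))
       (Cond (Conj (NLess (NConst 0) size_var) (Neg (RLess (RMem (NConst 2)) (RMem (NConst 0)))))
         (RStore (NConst 0) (RMem (NConst 2))) Skip)"

definition mask_prog :: com where
  "mask_prog =
     Seq (NStore (NConst 2) Size)
    (Seq (NStore (NConst 3) mask_var)
    (Seq (NStore (NConst 4) (NConst 0))
    (Seq (While (NLess (NConst 0) index_var) bit_prog)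
    (Seq (Query (NConst 0) (list_addr (NConst 0)) size_var)
    (Seq choose_prog
    (Seq (RStore (table_addr mask_var) (RMem (NConst 0)))
         (NStore (NConst 0) (NAdd mask_var (NConst 1)))))))))"

definition sens_prep_prog :: com where
  "sens_prep_prog = Seq powers_prog (While (NLess mask_var (NMem (power_addr Size))) mask_prog)"

definition powers_stored :: "nat \<Rightarrow> store \<Rightarrow> bool" where
  "powers_stored n s \<longleftrightarrow> (\<forall>j\<le>n. fst s (5 + j) = 2 ^ j)"

definition mask_inv ::
    "(('i, 'r) database \<Rightarrow> real) \<Rightarrow> ('i \<Rightarrow> real) \<Rightarrow> ('i \<times> 'r) list \<Rightarrow> nat \<Rightarrow> store \<Rightarrow> bool" where
  "mask_inv f \<Delta> xs m s \<longleftrightarrow> powers_stored (length xs) s \<and> fst s 0 = m \<and>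
     (\<forall>m'<m. snd s (3 + m') = sens_prep f \<Delta> (db_of_mask xs m')) \<and>
     (0 < m \<longrightarrow> snd s 0 = sens_prep f \<Delta> (db_of_mask xs (m - 1)))"

definition bit_inv ::
    "(('i, 'r) database \<Rightarrow> real) \<Rightarrow> ('i \<Rightarrow> real) \<Rightarrow> ('i \<times> 'r) list \<Rightarrow> nat \<Rightarrow> nat \<Rightarrow> store \<Rightarrow> bool" where
  "bit_inv f \<Delta> xs m j s \<longleftrightarrow>
     (let n = length xs; ps = high_bits n m j;
          g = \<lambda>p. sens_prep f \<Delta> (db_of_mask xs (m - 2 ^ p))
      in powers_stored n s \<and> fst s 0 = m \<and>
         (\<forall>m'<m. snd s (3 + m') = sens_prep f \<Delta> (db_of_mask xs m')) \<and>
         fst s 2 = j \<and> fst s 3 = take_bit j m \<and> fst s 4 = length ps \<and>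
         map (fst s) [6 + n..<6 + n + length ps] = ps \<and>
         (ps \<noteq> [] \<longrightarrow> snd s 1 = Min ((\<lambda>p. g p + \<Delta> (fst (xs ! p))) ` set ps) \<and>
                    snd s 2 = Max ((\<lambda>p. g p - \<Delta> (fst (xs ! p))) ` set ps)))"

lemma runs_powers_prog:
  assumes "fst s 0 = 0" "fst s 2 = 0"
  shows "runs f T \<Delta> xs powers_prog s (length xs * 3 + 2) (mask_inv f \<Delta> xs 0)"
proof -
  define I where "I i s \<longleftrightarrow> powers_stored i s \<and> fst s 0 = 0 \<and> fst s 2 = i" for i and s :: store
  have step: "I (Suc i) ((fst s)(6 + i := fst s (5 + i) + fst s (5 + i), 2 := Suc i), snd s)"
    if "I i s" for i s
    using that by (auto simp: I_def powers_stored_def le_Suc_eq)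
  let ?s = "((fst s)(5 := 1), snd s)"
  have "runs f T \<Delta> xs (While (NLess index_var Size) double_prog) ?s
      (length xs * (2 + 1) + 1) (I (length xs))"
  proof (rule runs_While)
    fix i s
    assume "i < length xs" "I i s"
    moreover have "fst s 2 = i" using \<open>I i s\<close> by (simp add: I_def)
    ultimately show "bval \<Delta> xs (NLess index_var Size) s \<and>
        runs f T \<Delta> xs double_prog s 2 (I (Suc i))"
      using step[of i s] by (auto simp: double_prog_def intro!: runs_Seq_NStore runs_NStore)
  qed (use assms in \<open>auto simp: I_def powers_stored_def\<close>)
  then show ?thesis
    unfolding powers_prog_def
    by (intro runs_Seq_NStore) (auto elim!: runs_mono simp: I_def mask_inv_def)
qed

lemma runs_bit_prog:
  assumes "j < length xs" "bit_inv f \<Delta> xs m (Suc j) s"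
  shows "runs f T \<Delta> xs bit_prog s 10 (bit_inv f \<Delta> xs m j)"
proof -
  obtain nm rm where s: "s = (nm, rm)" by (cases s)
  define n ps g where "n = length xs" and "ps = high_bits n m (Suc j)"
    and "g = (\<lambda>p. sens_prep f \<Delta> (db_of_mask xs (m - 2 ^ p)))"
  have inv: "\<And>j. j \<le> n \<Longrightarrow> nm (5 + j) = 2 ^ j" "nm 0 = m"
      "\<And>m'. m' < m \<Longrightarrow> rm (3 + m') = sens_prep f \<Delta> (db_of_mask xs m')"
      "nm 2 = Suc j" "nm 3 = take_bit (Suc j) m" "nm 4 = length ps"
      "map nm [6 + n..<6 + n + length ps] = ps"
      "ps \<noteq> [] \<Longrightarrow> rm 1 = Min ((\<lambda>p. g p + \<Delta> (fst (xs ! p))) ` set ps)"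
      "ps \<noteq> [] \<Longrightarrow> rm 2 = Max ((\<lambda>p. g p - \<Delta> (fst (xs ! p))) ` set ps)"
    using assms(2) by (auto simp: bit_inv_def Let_def s n_def ps_def g_def powers_stored_def)
  have pow: "nm (5 + j) = 2 ^ j" using inv(1) assms(1) by (simp add: n_def)
  have hb: "high_bits n m j = ps @ (if bit m j then [j] else [])"
    using assms(1) by (simp add: high_bits_step ps_def n_def)
  show ?thesis
  proof (cases "bit m j")
    case False
    then have less: "nm 3 < 2 ^ j"
      using inv(5) le_take_bit_Suc_iff[of j m] by simp
    have "map (nm(2 := j)) [6 + n..<6 + n + length ps] = map nm [6 + n..<6 + n + length ps]"
      by auto
    with inv(7) have "map (nm(2 := j)) [6 + n..<6 + n + length ps] = ps" by simp
    moreover have "take_bit (Suc j) m = take_bit j m"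
      using False by (simp add: take_bit_Suc_nat)
    moreover have "high_bits n m j = ps" using hb False by simp
    ultimately have "bit_inv f \<Delta> xs m j (nm(2 := j), rm)"
      unfolding bit_inv_def Let_def powers_stored_def fst_conv snd_conv n_def[symmetric]
      using inv unfolding g_def by (intro conjI allI impI) simp_all
    then show ?thesis
      unfolding bit_prog_def s
      using inv(4) pow less by (intro runs_Seq_NStore runs_Cond runs_Skip) auto
  next
    case True
    have table: "rm (3 + (m - 2 ^ j)) = g j"
      using inv(3) bit_nat_diff_exp(2)[OF True] by (simp add: g_def)
    define a where "a = g j + \<Delta> (fst (xs ! j))"
    define b where "b = g j - \<Delta> (fst (xs ! j))"
    define rm1 where "rm1 = (if ps = [] \<or> a < rm 1 then rm(1 := a) else rm)"
    define rm2 where "rm2 = (if ps = [] \<or> rm 2 < b then rm1(2 := b) else rm1)"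
    define nm' where "nm' = nm(2 := j, 6 + n + length ps := j, 4 := Suc (length ps), 3 := take_bit j m)"
    have rm1_2: "rm1 2 = rm 2" by (simp add: rm1_def)
    have min: "rm2 1 = Min ((\<lambda>p. g p + \<Delta> (fst (xs ! p))) ` set (ps @ [j]))"
    proof (cases "ps = []")
      case False
      have "rm2 1 = min a (rm 1)" using False by (simp add: rm1_def rm2_def)
      then show ?thesis using inv(8)[OF False] False by (simp add: a_def)
    qed (simp add: rm1_def rm2_def a_def)
    have max: "rm2 2 = Max ((\<lambda>p. g p - \<Delta> (fst (xs ! p))) ` set (ps @ [j]))"
    proof (cases "ps = []")
      case False
      have "rm2 2 = max b (rm 2)" using False by (simp add: rm1_2 rm2_def)
      then show ?thesis using inv(9)[OF False] False by (simp add: b_def)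
    qed (simp add: rm1_def rm2_def b_def)
    have table1: "rm1 (3 + m') = rm (3 + m')" for m'
      by (simp add: rm1_def)
    have table': "rm2 (3 + m') = rm (3 + m')" for m'
      by (simp add: rm1_def rm2_def)
    have "map nm' [6 + n..<6 + n + length ps] = map nm [6 + n..<6 + n + length ps]"
      by (auto simp: nm'_def)
    moreover have "[6 + n..<6 + n + length (ps @ [j])] = [6 + n..<6 + n + length ps] @ [6 + n + length ps]"
      by (simp only: length_append list.size add_0_left add_Suc_right add_0_right upt_Suc_append le_add1)
    moreover have "nm' (6 + n + length ps) = j"
      by (simp add: nm'_def)
    ultimately have list: "map nm' [6 + n..<6 + n + length (ps @ [j])] = ps @ [j]"
      using inv(7) by (simp only: map_append list.map)
    have "high_bits n m j = ps @ [j]" using hb True by simp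
    moreover have "nm' 0 = m" "nm' 2 = j" "nm' 3 = take_bit j m" "nm' 4 = length (ps @ [j])"
      using inv(2) by (simp_all add: nm'_def)
    moreover have "nm' (5 + i) = 2 ^ i" if "i \<le> n" for i
      using inv(1)[OF that] that by (simp add: nm'_def)
    ultimately have fin: "bit_inv f \<Delta> xs m j (nm', rm2)"
      unfolding bit_inv_def Let_def powers_stored_def fst_conv snd_conv n_def[symmetric]
      using list inv(3) table' min max unfolding g_def
      by (intro conjI allI impI) (simp_all only:)
    have rest: "2 ^ j \<le> take_bit (Suc j) m" "take_bit (Suc j) m - 2 ^ j = take_bit j m"
      using True by (simp_all add: take_bit_Suc_nat)
    have "runs f T \<Delta> xs append_prog (nm(2 := j), rm2) 3 (bit_inv f \<Delta> xs m j)"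
      unfolding append_prog_def
    proof (intro runs_Seq_NStore runs_NStore)
    qed (use fin inv(4-6) pow rest assms(1) in \<open>simp_all add: nm'_def n_def\<close>)
    then have "runs f T \<Delta> xs (Seq lower_prog append_prog) (nm(2 := j), rm1) 5
        (bit_inv f \<Delta> xs m j)"
      unfolding lower_prog_def
    proof (rule runs_Seq_Cond_RStore)
    qed (use inv(2,6) pow table assms(1) in \<open>simp_all add: rm1_2 table1 rm2_def b_def\<close>)
    then have "runs f T \<Delta> xs (Seq upper_prog (Seq lower_prog append_prog)) (nm(2 := j), rm) 7
        (bit_inv f \<Delta> xs m j)"
      unfolding upper_prog_def
    proof (rule runs_Seq_Cond_RStore)
    qed (use inv(2,6) pow table assms(1) in \<open>simp_all add: rm1_def a_def\<close>)
    then show ?thesis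
      unfolding bit_prog_def s
      using inv(4,5) pow rest(1)
      by (intro runs_Seq_NStore runs_Cond) (auto elim: runs_mono)
  qed
qed

lemma runs_mask_prog:
  fixes f :: "('i, 'r) database \<Rightarrow> real"
  assumes "mono T" "distinct (map fst xs)" "m < 2 ^ length xs" "mask_inv f \<Delta> xs m s"
  shows "runs f T \<Delta> xs mask_prog s (11 * length xs + T (length xs) + 10) (mask_inv f \<Delta> xs (Suc m))"
proof -
  obtain nm rm where s: "s = (nm, rm)" by (cases s)
  define n ps g where "n = length xs" and "ps = high_bits n m 0"
    and "g = (\<lambda>m. sens_prep f \<Delta> (db_of_mask xs m))"
  define W where "W s \<longleftrightarrow> powers_stored n s \<and> fst s 0 = m \<and> (\<forall>m'<m. snd s (3 + m') = g m')" for s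
  define R where "R s \<longleftrightarrow> W s \<and> fst s 4 = length ps \<and> snd s 0 = f (db_of_mask xs m) \<and>
      (ps \<noteq> [] \<longrightarrow> snd s 1 = Min ((\<lambda>p. g (m - 2 ^ p) + \<Delta> (fst (xs ! p))) ` set ps) \<and>
                  snd s 2 = Max ((\<lambda>p. g (m - 2 ^ p) - \<Delta> (fst (xs ! p))) ` set ps))" for s
  let ?store = "Seq (RStore (table_addr mask_var) (RMem (NConst 0)))
      (NStore (NConst 0) (NAdd mask_var (NConst 1)))"
  have store: "runs f T \<Delta> xs ?store s 2 (mask_inv f \<Delta> xs (Suc m))" if "W s" "snd s 0 = g m" for s
    using that
    by (cases s, intro runs_Seq_RStore runs_NStore)
      (auto simp: W_def mask_inv_def powers_stored_def n_def g_def less_Suc_eq)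
  have ps: "ps \<noteq> [] \<longleftrightarrow> {p. p < length xs \<and> bit m p} \<noteq> {}"
    using set_high_bits[of n m 0] by (auto simp: ps_def n_def simp del: set_high_bits simp flip: set_empty)
  have set_ps: "set ps = {p. p < length xs \<and> bit m p}"
    by (simp add: ps_def n_def)
  have choose: "runs f T \<Delta> xs choose_prog s 3 (\<lambda>s. W s \<and> snd s 0 = g m)" if "R s" for s
  proof -
    have W: "W (fst s, (snd s)(0 := v))" for v
      using that by (simp add: R_def W_def powers_stored_def)
    have g: "g m = (if ps \<noteq> [] \<and> snd s 1 \<le> snd s 0 then snd s 1
        else if ps \<noteq> [] \<and> snd s 0 \<le> snd s 2 then snd s 2 else snd s 0)"
      using that sens_prep_db_of_mask[OF assms(2), where f = f and \<Delta> = \<Delta> and m = m]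
      unfolding R_def ps set_ps g_def by auto
    show ?thesis
      unfolding choose_prog_def
      using that W g by (intro runs_Cond runs_RStore runs_Skip) (auto simp: R_def not_less)
  qed
  have query: "runs f T \<Delta> xs (Query (NConst 0) (list_addr (NConst 0)) size_var) s (1 + T n) R"
    if "bit_inv f \<Delta> xs m 0 s" for s
  proof (rule runs_Query[where ps = ps])
    show "distinct ps" "set ps \<subseteq> {..<length xs}"
      by (auto simp: ps_def n_def distinct_high_bits)
    show "1 + T (length ps) \<le> 1 + T n"
      using length_high_bits[of n m 0] assms(1) by (simp add: ps_def monoD)
    show "map (fst s) [nval (length xs) (list_addr (NConst 0)) s..<
        nval (length xs) (list_addr (NConst 0)) s + nval (length xs) size_var s] = ps"
      using that by (simp add: bit_inv_def Let_def ps_def n_def)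
    show "R (fst s, (snd s)(nval (length xs) (NConst 0) s := f (fmap_of_list (map ((!) xs) ps))))"
      using that unfolding bit_inv_def Let_def R_def W_def powers_stored_def g_def ps_def n_def
      by (auto simp: db_of_mask_def)
  qed
  have loop: "runs f T \<Delta> xs (While (NLess (NConst 0) index_var) bit_prog) s (n * (10 + 1) + 1)
      (\<lambda>s. bit_inv f \<Delta> xs m (n - n) s)" if "bit_inv f \<Delta> xs m n s" for s
  proof (rule runs_While[where I = "\<lambda>i. bit_inv f \<Delta> xs m (n - i)"])
    fix i s
    assume i: "i < n" "bit_inv f \<Delta> xs m (n - i) s"
    then have "bit_inv f \<Delta> xs m (Suc (n - Suc i)) s"
      by (simp add: Suc_diff_Suc)
    moreover have "n - Suc i < length xs" using i by (simp add: n_def)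
    moreover have "bval \<Delta> xs (NLess (NConst 0) index_var) s"
      using i by (simp add: bit_inv_def Let_def)
    ultimately show "bval \<Delta> xs (NLess (NConst 0) index_var) s \<and>
        runs f T \<Delta> xs bit_prog s 10 (bit_inv f \<Delta> xs m (n - Suc i))"
      using runs_bit_prog by blast
  qed (use that in \<open>simp_all add: bit_inv_def Let_def\<close>)
  have init: "bit_inv f \<Delta> xs m n (nm(2 := n, 3 := m, 4 := 0), rm)"
    using assms(3,4) unfolding bit_inv_def mask_inv_def Let_def powers_stored_def s n_def
    by (auto simp: take_bit_nat_eq_self)
  have "runs f T \<Delta> xs (Seq choose_prog ?store) s 5 (mask_inv f \<Delta> xs (Suc m))" if "R s" for s
    using store by (intro runs_Seq[OF choose[OF that]]) auto
  then have "runs f T \<Delta> xs (Seq (Query (NConst 0) (list_addr (NConst 0)) size_var)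
      (Seq choose_prog ?store)) s (T n + 6) (mask_inv f \<Delta> xs (Suc m))" if "bit_inv f \<Delta> xs m 0 s" for s
    by (intro runs_Seq[OF query[OF that]]) auto
  then have "runs f T \<Delta> xs (Seq (While (NLess (NConst 0) index_var) bit_prog)
      (Seq (Query (NConst 0) (list_addr (NConst 0)) size_var) (Seq choose_prog ?store))) s
      (11 * n + T n + 7) (mask_inv f \<Delta> xs (Suc m))" if "bit_inv f \<Delta> xs m n s" for s
    by (intro runs_Seq[OF loop[OF that]]) auto
  note rest = this[OF init]
  have "nm 0 = m"
    using assms(4) by (simp add: mask_inv_def s)
  then show ?thesis
    unfolding mask_prog_def s
    by (intro runs_Seq_NStore) (use rest in \<open>simp_all add: ac_simps flip: n_def\<close>)
qed

lemma runs_sens_prep_prog: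
  fixes f :: "('i, 'r) database \<Rightarrow> real"
  assumes "mono T" "lists_database xs D"
  shows "runs f T \<Delta> xs sens_prep_prog (\<lambda>_. 0, \<lambda>_. 0)
    (length xs * 3 + 3 + 2 ^ length xs * (11 * length xs + T (length xs) + 11))
    (\<lambda>s. snd s 0 = sens_prep f \<Delta> D)"
  unfolding sens_prep_prog_def
proof (rule runs_Seq)
  show "runs f T \<Delta> xs powers_prog (\<lambda>_. 0, \<lambda>_. 0) (length xs * 3 + 2) (mask_inv f \<Delta> xs 0)"
    by (rule runs_powers_prog) simp_all
next
  fix s
  assume init: "mask_inv f \<Delta> xs 0 s"
  have "distinct (map fst xs)"
    using assms(2) by (simp add: lists_database_def)
  note mask = runs_mask_prog[OF assms(1) this, where f = f and \<Delta> = \<Delta>]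
  have "runs f T \<Delta> xs (While (NLess mask_var (NMem (power_addr Size))) mask_prog) s
    (2 ^ length xs * (11 * length xs + T (length xs) + 10 + 1) + 1) (mask_inv f \<Delta> xs (2 ^ length xs))"
  proof (rule runs_While)
    fix m s
    assume "m < 2 ^ length xs" "mask_inv f \<Delta> xs m s"
    then show "bval \<Delta> xs (NLess mask_var (NMem (power_addr Size))) s \<and> runs f T \<Delta> xs mask_prog s
        (11 * length xs + T (length xs) + 10) (mask_inv f \<Delta> xs (Suc m))"
      using mask[of m s] by (simp add: mask_inv_def powers_stored_def)
  qed (use init in \<open>simp_all add: mask_inv_def powers_stored_def\<close>)
  then show "runs f T \<Delta> xs (While (NLess mask_var (NMem (power_addr Size))) mask_prog) s
    (2 ^ length xs * (11 * length xs + T (length xs) + 11) + 1) (\<lambda>s. snd s 0 = sens_prep f \<Delta> D)"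
    by (rule runs_mono) (use db_of_mask_full[OF assms(2)] in \<open>simp_all add: mask_inv_def\<close>)
qed simp

lemma sens_prep_time_bigo:
  "(\<lambda>n. real (n * 3 + 3 + 2 ^ n * (11 * n + T n + 11))) \<in> O(\<lambda>n. (real (T n) + real n) * 2 ^ n)"
proof (rule bigoI)
  have bound: "n * 3 + 3 + 2 ^ n * (11 * n + T n + 11) \<le> 28 * ((T n + n) * 2 ^ n)" if "1 \<le> n" for n
  proof -
    have "n * 1 \<le> n * 2 ^ n"
      by (intro mult_le_mono2) simp
    with that have "n * 3 + 3 \<le> 6 * (n * 2 ^ n)"
      by linarith
    moreover have "2 ^ n * 1 \<le> 2 ^ n * n"
      using that by (intro mult_le_mono2)
    then have "2 ^ n * (11 * n + T n + 11) \<le> 22 * (n * 2 ^ n) + T n * 2 ^ n"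
      by (simp add: algebra_simps)
    moreover have "28 * ((T n + n) * 2 ^ n) = 28 * (T n * 2 ^ n) + 28 * (n * 2 ^ n)"
      by (simp add: algebra_simps)
    ultimately show ?thesis
      by linarith
  qed
  then have "norm (real (n * 3 + 3 + 2 ^ n * (11 * n + T n + 11)))
      \<le> 28 * norm ((real (T n) + real n) * 2 ^ n)" if "1 \<le> n" for n
  proof -
    have "real (n * 3 + 3 + 2 ^ n * (11 * n + T n + 11)) \<le> real (28 * ((T n + n) * 2 ^ n))"
      using that bound by (simp only: of_nat_le_iff)
    also have "\<dots> = 28 * norm ((real (T n) + real n) * 2 ^ n)"
      by simp
    finally show ?thesis
      by (simp only: real_norm_def abs_of_nat)
  qed
  then show "\<forall>\<^sub>F n in at_top. norm (real (n * 3 + 3 + 2 ^ n * (11 * n + T n + 11)))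
      \<le> 28 * norm ((real (T n) + real n) * 2 ^ n)"
    by (rule eventually_at_top_linorderI)
qed

theorem theorem3p3:
  "(\<exists>P. \<forall>T :: nat \<Rightarrow> nat. mono T \<longrightarrow>
      (\<exists>t :: nat \<Rightarrow> nat.
         (\<lambda>n. real (t n)) \<in> O(\<lambda>n. (real (T n) + real n) * 2 ^ n) \<and>
         (\<forall>(U :: ('i, 'r) database set) (f :: ('i, 'r) database \<Rightarrow> real) (\<Delta> :: 'i \<Rightarrow> real).
            data_universe U \<and> (\<forall>i. 0 \<le> \<Delta> i) \<longrightarrow>
            (\<forall>D\<in>U. \<forall>xs. lists_database xs D \<longrightarrow>
               computes_within P f T \<Delta> xs (sens_prep f \<Delta> D) (t (length xs)))))) \<and>
   (\<forall>(U :: ('i, 'r) database set) (f :: ('i, 'r) database \<Rightarrow> real) (\<Delta> :: 'i \<Rightarrow> real).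
      data_universe U \<and> (\<forall>i. 0 \<le> \<Delta> i) \<longrightarrow>
      (\<forall>i. individual_sensitivity U (sens_prep f \<Delta>) i \<le> ennreal (\<Delta> i)) \<and>
      (\<forall>D\<in>U. \<forall>xs. lists_database xs D \<longrightarrow>
         \<bar>f D - sens_prep f \<Delta> D\<bar>
           \<le> Max (perm_error f \<Delta> xs ` {\<sigma>. \<sigma> permutes {..<length xs}})))"
proof (intro conjI allI impI ballI)
  show "\<exists>P. \<forall>T :: nat \<Rightarrow> nat. mono T \<longrightarrow>
      (\<exists>t :: nat \<Rightarrow> nat.
         (\<lambda>n. real (t n)) \<in> O(\<lambda>n. (real (T n) + real n) * 2 ^ n) \<and>
         (\<forall>(U :: ('i, 'r) database set) (f :: ('i, 'r) database \<Rightarrow> real) (\<Delta> :: 'i \<Rightarrow> real).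
            data_universe U \<and> (\<forall>i. 0 \<le> \<Delta> i) \<longrightarrow>
            (\<forall>D\<in>U. \<forall>xs. lists_database xs D \<longrightarrow>
               computes_within P f T \<Delta> xs (sens_prep f \<Delta> D) (t (length xs)))))"
  proof (intro exI[of _ sens_prep_prog] allI impI)
    fix T :: "nat \<Rightarrow> nat"
    assume "mono T"
    let ?t = "\<lambda>n. n * 3 + 3 + 2 ^ n * (11 * n + T n + 11)"
    have "computes_within sens_prep_prog f T \<Delta> xs (sens_prep f \<Delta> D) (?t (length xs))"
      if "lists_database xs D" for f :: "('i, 'r) database \<Rightarrow> real" and \<Delta> xs D
      using runs_sens_prep_prog[OF \<open>mono T\<close> that, of f \<Delta>]
      unfolding runs_def computes_within_def by blast
    with sens_prep_time_bigo[of T] show "\<exists>t :: nat \<Rightarrow> nat.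
         (\<lambda>n. real (t n)) \<in> O(\<lambda>n. (real (T n) + real n) * 2 ^ n) \<and>
         (\<forall>(U :: ('i, 'r) database set) (f :: ('i, 'r) database \<Rightarrow> real) (\<Delta> :: 'i \<Rightarrow> real).
            data_universe U \<and> (\<forall>i. 0 \<le> \<Delta> i) \<longrightarrow>
            (\<forall>D\<in>U. \<forall>xs. lists_database xs D \<longrightarrow>
               computes_within sens_prep_prog f T \<Delta> xs (sens_prep f \<Delta> D) (t (length xs))))"
      by (intro exI[of _ ?t] conjI allI impI ballI)
  qed
qed (auto intro: individual_sensitivity_sens_prep sens_prep_error)

end
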